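(* Let $\mathfrak{p},\mathfrak{q}\in\mathbb{C}$, let $\mathcal{L}$ be a moment functional satisfying the standing assumptions in the context (including the Hankel determinant conditions for all $t\ge 0$), and let $\mathcal{L}^{(t)}$, $t\ge 0$, be the associated functionals $\mathcal{L}^{(t)}[x^k]=\mathcal{L}[e^{-t(\mathfrak{p}x+\mathfrak{q}/x)}x^k]$, $k\in\mathbb{Z}$. Let $Q_n(x;t)$ be the L-orthogonal polynomials with respect to $\mathcal{L}^{(t)}$ and let $\beta_n=\beta_n(t)$ $(n\ge 1)$, $\alpha_{n}=\alpha_{n}(t)$ $(n\ge 2)$ be the coefficients of their three term recurrence relation $$Q_{n+1}(x;t)=[x-\beta_{n+1}(t)]Q_n(x;t)-\alpha_{n+1}(t)\,x\,Q_{n-1}(x;t),\quad n\ge 1,$$ $Q_0(x;t)=1$, $Q_1(x;t)=x-\beta_1(t)$. Set $\beta_0(t)=1$, $\alpha_0(t)=-1$, $\alpha_1(t)=0$. Then, for all $n\ge 1$ and $t\geq 0$ (a dot denoting $d/dt$), $$\dot\beta_n=\mathfrak{p}\,\beta_n(\alpha_n-\alpha_{n+1})+\mathfrak{q}\,\beta_n\left(\frac{\alpha_{n+1}}{\beta_{n+1}\beta_n}-\frac{\alpha_n}{\beta_n\beta_{n-1}}\right)$$ and $$\dot\alpha_n=\mathfrak{p}\,\alpha_n(\alpha_{n-1}+\beta_{n-1}-\alpha_{n+1}-\beta_n)+\mathfrak{q}\,\alpha_n\left(\frac{1}{\beta_{n-1}}-\frac{1}{\beta_n}\right).$$ Moreover,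 with $\gamma_n=\alpha_{n+1}+\beta_n$ for $n\ge 1$, $$\dot\gamma_n=\mathfrak{p}\,(\alpha_n\gamma_n-\alpha_{n+1}\gamma_{n+1})+\mathfrak{q}\left(\frac{\alpha_{n+1}}{\beta_n}-\frac{\alpha_n}{\beta_{n-1}}\right),\quad n\ge 1.$$
   Context: Standing assumptions. $\mathcal{L}$ is a (complex-valued, linear) moment functional on the Laurent polynomials in $x$ such that $\mathcal{L}[e^{-t(\mathfrak{p}x+\mathfrak{q}/x)}x^k]$ also exists for all $k\in\mathbb{Z}$ and all $t\ge 0$, and such that $$\frac{d}{dt}\mathcal{L}\left[e^{-t(\mathfrak{p}x+\mathfrak{q}/x)}f(x,t)\right]=\mathcal{L}\left[\frac{\partial}{\partial t}\left(e^{-t(\mathfrak{p}x+\mathfrak{q}/x)}f(x,t)\right)\right]$$ for every $f(x,t)$ that is a Laurent polynomial in $x$ and absolutely continuous in $t$ for $t\ge 0$. Put $\nu_k^{(t)}=\mathcal{L}^{(t)}[x^k]=\mathcal{L}[e^{-t(\mathfrak{p}x+\mathfrak{q}/x)}x^k]$, $k\in\mathbb{Z}$; $\mathcal{L}^{(t)}$ is extended linearly to Laurent polynomials. (In particular $\dot\nu_k^{(t)}=-\mathfrak{p}\,\nu_{k+1}^{(t)}-\mathfrak{q}\,\nu_{k-1}^{(t)}$.) Derivatives at $t=0$ are one-sided. Hankel determinants: $H_0^{(m)}(t)=1$ and $H_n^{(m)}(t)=\det\big(\nu^{(t)}_{m+i+j}\big)_{i,j=0}^{n-1}$ for $n\ge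 1$, $m\in\mathbb{Z}$. It is assumed that $H_n^{(-n)}(t)\ne 0$ and $H_{n+1}^{(-n)}(t)\neq 0$ for all $n\ge 0$, $t\ge 0$. L-orthogonal polynomials: $Q_0(x;t)=1$ and, for $n\ge 1$, $Q_n(x;t)$ is the monic polynomial of degree $n$ in $x$ with $\mathcal{L}^{(t)}[x^{-n+s}Q_n(x;t)]=0$ for $s=0,1,\dots,n-1$. Under the Hankel conditions these polynomials exist, are unique, and it is known that they satisfy the three term recurrence relation in the claim, with uniquely determined coefficients, $\beta_n(t)\ne0$ for $n\ge1$ and $\alpha_{n}(t)\neq 0$ for $n\ge 2$; explicitly, $\beta_1(t)=\nu_0^{(t)}/\nu_{-1}^{(t)}$ and, for $n\ge1$, $\alpha_{n+1}(t)=\sigma_{n,n}(t)/\sigma_{n-1,n-1}(t)$, $\beta_{n+1}(t)=-\alpha_{n+1}(t)\,\sigma_{n-1,-1}(t)/\sigma_{n,-1}(t)$, where $\sigma_{n,n}(t)=\mathcal{L}^{(t)}[Q_n(x;t)]$ and $\sigma_{n,-1}(t)=\mathcal{L}^{(t)}[x^{-n-1}Q_n(x;t)]$. *)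

theory Defs
  imports
    "HOL-Analysis.Analysis"
    "Jordan_Normal_Form.Determinant"
begin

definition abs_continuous_on :: "real set \<Rightarrow> (real \<Rightarrow> complex) \<Rightarrow> bool" where
  "abs_continuous_on S c \<longleftrightarrow>
     (\<forall>\<epsilon>>0. \<exists>\<delta>>0. \<forall>\<D> T. \<D> division_of T \<and> T \<subseteq> S \<and> (\<Sum>I\<in>\<D>. Sup I - Inf I) < \<delta> \<longrightarrow>
        (\<Sum>I\<in>\<D>. norm (c (Sup I) - c (Inf I))) < \<epsilon>)"

definition toda_weight :: "complex \<Rightarrow> complex \<Rightarrow> real \<Rightarrow> complex \<Rightarrow> complex" where
  "toda_weight p q t x = exp (- complex_of_real t * (p * x + q / x))"

text \<open>A functional \<open>L\<close> need not be defined on all functions, so it comes with a linear space \<open>D\<close>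
  of functions to which it applies. Laurent polynomials are functions on the punctured plane: the
  last clause says that \<open>L\<close> ignores the value at \<open>0\<close>, where \<open>x powi k\<close> and \<open>q / x\<close> are only
  conventions.\<close>

definition linear_functional_on ::
    "(complex \<Rightarrow> complex) set \<Rightarrow> ((complex \<Rightarrow> complex) \<Rightarrow> complex) \<Rightarrow> bool" where
  "linear_functional_on D L \<longleftrightarrow>
     (\<lambda>x. 0) \<in> D \<and>
     (\<forall>f\<in>D. \<forall>g\<in>D. (\<lambda>x. f x + g x) \<in> D \<and> L (\<lambda>x. f x + g x) = L f + L g) \<and>
     (\<forall>c. \<forall>f\<in>D. (\<lambda>x. c * f x) \<in> D \<and> L (\<lambda>x. c * f x) = c * L f) \<and>
     (\<forall>f\<in>D. \<forall>g. (\<forall>x. x \<noteq> 0 \<longrightarrow> g x = f x) \<longrightarrow> g \<in> D \<and> L g = L f)"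

text \<open>The last clause below is differentiation under \<open>L\<close> for
  \<open>f(x,t) = (\<Sum>k\<in>K. c k t * x powi k)\<close> with coefficients absolutely continuous on every \<open>{0..b}\<close>.
  Such coefficients may fail to be differentiable on a null set, so the identity is required at the
  times \<open>t\<close> at which all of them are. The filter \<open>at t within {0..}\<close> makes derivatives
  at \<open>t = 0\<close> one-sided. Membership in \<open>D\<close> at \<open>t = 0\<close> covers the Laurent polynomials themselves.\<close>

definition toda_moment_functional ::
    "complex \<Rightarrow> complex \<Rightarrow> (complex \<Rightarrow> complex) set \<Rightarrow> ((complex \<Rightarrow> complex) \<Rightarrow> complex) \<Rightarrow> bool"
  where
  "toda_moment_functional p q D L \<longleftrightarrow>
     linear_functional_on D L \<and>
     (\<forall>t\<ge>0. \<forall>k. (\<lambda>x. toda_weight p q t x * x powi k) \<in> D) \<and>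
     (\<forall>(K :: int set) (c :: int \<Rightarrow> real \<Rightarrow> complex).
        finite K \<and> (\<forall>k\<in>K. \<forall>b\<ge>0. abs_continuous_on {0..b} (c k)) \<longrightarrow>
        (\<forall>t\<ge>0. (\<forall>k\<in>K. c k differentiable (at t within {0..})) \<longrightarrow>
          ((\<lambda>s. L (\<lambda>x. toda_weight p q s x * (\<Sum>k\<in>K. c k s * x powi k)))
             has_vector_derivative
               L (\<lambda>x. vector_derivative
                        (\<lambda>s. toda_weight p q s x * (\<Sum>k\<in>K. c k s * x powi k))
                        (at t within {0..})))
            (at t within {0..})))"

definition deformed_functional ::
    "complex \<Rightarrow> complex \<Rightarrow> ((complex \<Rightarrow> complex) \<Rightarrow> complex) \<Rightarrow> real \<Rightarrow> (complex \<Rightarrow> complex) \<Rightarrow> complex"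
  where
  "deformed_functional p q L t f = L (\<lambda>x. toda_weight p q t x * f x)"

text \<open>For \<open>n = 0\<close> this is the determinant of the empty matrix, which is \<open>1\<close>.\<close>

definition hankel_det :: "((complex \<Rightarrow> complex) \<Rightarrow> complex) \<Rightarrow> int \<Rightarrow> nat \<Rightarrow> complex" where
  "hankel_det M m n =
     Determinant.det (Matrix.mat n n (\<lambda>(i, j). M (\<lambda>x. x powi (m + int i + int j))))"

definition L_orthogonal_poly ::
    "((complex \<Rightarrow> complex) \<Rightarrow> complex) \<Rightarrow> nat \<Rightarrow> complex poly \<Rightarrow> bool" where
  "L_orthogonal_poly M n P \<longleftrightarrow>
     degree P = n \<and> lead_coeff P = 1 \<and>
     (\<forall>s<n. M (\<lambda>x. x powi (- int n + int s) * poly P x) = 0)"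

end

theory Submission
  imports Defs
begin

text \<open>The moments obey \<open>\<nu>\<^sub>k' = - p \<nu>\<^sub>k\<^sub>+\<^sub>1 - q \<nu>\<^sub>k\<^sub>-\<^sub>1\<close>. Differentiating the orthogonality
  relations of \<open>Q\<^sub>n\<close> shows that the polynomial \<open>Q\<^sub>n'\<close> (of degree below \<open>n\<close>) is orthogonal to all
  \<open>x\<^sup>k\<close> with \<open>- n < k < - 1\<close> and gives its moments against \<open>x\<^sup>-\<^sup>1\<close> and
  \<open>x\<^sup>-\<^sup>n\<close>, which by the nondegeneracy of the Hankel determinants forces
  \<open>Q\<^sub>n' = p \<alpha>\<^sub>n\<^sub>+\<^sub>1 (x Q\<^sub>n\<^sub>-\<^sub>1 - Q\<^sub>n) - q (\<alpha>\<^sub>n\<^sub>+\<^sub>1 / \<beta>\<^sub>n\<^sub>+\<^sub>1) Q\<^sub>n\<^sub>-\<^sub>1\<close>.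
  Since \<open>Q\<^sub>n(0) = (- 1)\<^sup>n \<beta>\<^sub>1 \<cdots> \<beta>\<^sub>n\<close> and the coefficient of \<open>x\<^sup>n\<^sup>-\<^sup>1\<close> in \<open>Q\<^sub>n\<close> is
  minus the sum of all \<open>\<alpha>\<^sub>j + \<beta>\<^sub>j\<close>, comparing these two coefficients gives the equations.\<close>

section \<open>Moments of polynomials against a moment sequence\<close>

text \<open>When \<open>\<mu>\<close> lists the moments of a functional, this is its value at x^k
  times \<open>P\<close>. Working with the sequence alone keeps function spaces and values at 0 out
  of the algebra.\<close>

definition lmoment :: "(int \<Rightarrow> complex) \<Rightarrow> int \<Rightarrow> complex poly \<Rightarrow> complex" where
  "lmoment \<mu> k P = (\<Sum>i\<le>degree P. Polynomial.coeff P i * \<mu> (k + int i))"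

lemma lmoment_eq_sum:
  assumes "degree P \<le> N"
  shows "lmoment \<mu> k P = (\<Sum>i\<le>N. Polynomial.coeff P i * \<mu> (k + int i))"
  unfolding lmoment_def using assms
  by (intro sum.mono_neutral_left) (auto simp: coeff_eq_0)

lemma lmoment_add: "lmoment \<mu> k (P + R) = lmoment \<mu> k P + lmoment \<mu> k R"
proof -
  let ?N = "max (degree P) (degree R)"
  have "degree (P + R) \<le> ?N" by (rule degree_add_le_max)
  then show ?thesis
    by (simp add: lmoment_eq_sum[of _ ?N] sum.distrib algebra_simps)
qed

lemma lmoment_smult: "lmoment \<mu> k (Polynomial.smult c P) = c * lmoment \<mu> k P"
  by (simp add: lmoment_eq_sum[of _ "degree P"] degree_smult_le sum_distrib_left mult.assoc)

lemma lmoment_diff: "lmoment \<mu> k (P - R) = lmoment \<mu> k P - lmoment \<mu> k R"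
  using lmoment_add[of \<mu> k P "Polynomial.smult (-1) R"] lmoment_smult[of \<mu> k "-1" R] by simp

text \<open>With \<open>a = 0\<close>: multiplication by x raises the exponent by one. This turns
  the three term recurrence into a recurrence for moments.\<close>

lemma lmoment_pCons:
  "lmoment \<mu> k (pCons a P) = a * \<mu> k + lmoment \<mu> (k + 1) P"
proof -
  have "lmoment \<mu> k (pCons a P) =
      (\<Sum>i\<le>Suc (degree P). Polynomial.coeff (pCons a P) i * \<mu> (k + int i))"
    by (rule lmoment_eq_sum) (rule degree_pCons_le)
  also have "\<dots> = a * \<mu> k + (\<Sum>i\<le>degree P. Polynomial.coeff P i * \<mu> (k + 1 + int i))"
    by (subst sum.atMost_Suc_shift) (simp add: algebra_simps)
  finally show ?thesis by (simp add: lmoment_def)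
qed

text \<open>The vanishing moments place the coefficient vector in the kernel of the Hankel matrix.
  From this come both the nonvanishing of boundary moments and the uniqueness of a polynomial with
  prescribed moments.\<close>

lemma lmoment_hankel_nonsingular:
  assumes det: "Determinant.det (Matrix.mat N N (\<lambda>(i, j). \<mu> (m + int i + int j))) \<noteq> 0"
    and deg: "P = 0 \<or> degree P < N"
    and orth: "\<And>k. m \<le> k \<Longrightarrow> k < m + int N \<Longrightarrow> lmoment \<mu> k P = 0"
  shows "P = 0"
proof (rule ccontr)
  assume P: "P \<noteq> 0"
  with deg have degN: "degree P < N" by simp
  let ?A = "Matrix.mat N N (\<lambda>(i, j). \<mu> (m + int i + int j))"
  let ?v = "Matrix.vec N (Polynomial.coeff P)"
  have "?A *\<^sub>v ?v = 0\<^sub>v N"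
  proof (rule Matrix.eq_vecI)
    fix i assume "i < dim_vec (0\<^sub>v N :: complex Matrix.vec)"
    then have i: "i < N" by simp
    have "(?A *\<^sub>v ?v) $ i = (\<Sum>j<N. \<mu> (m + int i + int j) * Polynomial.coeff P j)"
      using i by (simp add: scalar_prod_def lessThan_atLeast0)
    also have "\<dots> = (\<Sum>j\<le>N - 1. Polynomial.coeff P j * \<mu> (m + int i + int j))"
      using degN by (intro sum.cong) (auto simp: mult.commute)
    also have "\<dots> = lmoment \<mu> (m + int i) P"
      using degN by (intro lmoment_eq_sum[symmetric]) simp
    also have "\<dots> = 0" using i by (intro orth) auto
    finally show "(?A *\<^sub>v ?v) $ i = 0\<^sub>v N $ i" using i by simp
  qed simp
  moreover have "?v \<noteq> 0\<^sub>v N"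
  proof
    assume "?v = 0\<^sub>v N"
    then have "?v $ degree P = 0\<^sub>v N $ degree P" by simp
    with degN P show False by simp
  qed
  ultimately have "Determinant.det ?A = 0"
    using det_0_iff_vec_prod_zero[of ?A N] by (auto intro!: exI[of _ ?v])
  with det show False ..
qed

section \<open>One-sided derivatives on the half-line\<close>

lemma has_vector_derivative_transform_eqI:
  assumes "(f has_vector_derivative f') (at t within S)"
    and "t \<in> S" "\<And>s. s \<in> S \<Longrightarrow> g s = f s" "f' = g'"
  shows "(g has_vector_derivative g') (at t within S)"
  using has_vector_derivative_transform[of t S g f f'] assms by auto

lemma differentiable_eqI:
  fixes f g :: "real \<Rightarrow> complex"
  assumes "f differentiable (at t within {0..})" "t \<ge> 0" "\<And>s. s \<ge> 0 \<Longrightarrow> g s = f s"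
  shows "g differentiable (at t within {0..})"
  using differentiable_transform_within[of f t "{0..}" 1 g] assms by auto

text \<open>Every point of the half-line, 0 included, is a limit of points to its right. Hence
  derivatives within \<open>{0..}\<close> are unique and two computed values may be equated.\<close>

lemma at_within_atLeast_neq_bot: "0 \<le> t \<Longrightarrow> at t within {0..} \<noteq> (bot :: real filter)"
  by (metis at_le atLeast_iff bot_unique greaterThan_iff less_imp_le order_trans subsetI
      trivial_limit_at_right_real)

section \<open>The recurrence coefficients as quotients of moments\<close>

text \<open>Only the moments and their differential equation are kept from the functional. At
  \<open>n = 0\<close> the truncated index \<open>n - 1\<close> is again 0, but
  \<open>\<alpha> 1 t = 0\<close> removes that term, so one formula covers \<open>Q 1\<close> as
  well.\<close>

locale toda_L_orthogonal =
  fixes p q :: complex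
    and \<nu> :: "real \<Rightarrow> int \<Rightarrow> complex"
    and Q :: "nat \<Rightarrow> real \<Rightarrow> complex poly"
    and \<alpha> \<beta> :: "nat \<Rightarrow> real \<Rightarrow> complex"
  assumes moment_deriv: "t \<ge> 0 \<Longrightarrow>
      ((\<lambda>s. \<nu> s k) has_vector_derivative - p * \<nu> t (k + 1) - q * \<nu> t (k - 1)) (at t within {0..})"
    and hankel: "t \<ge> 0 \<Longrightarrow>
      Determinant.det (Matrix.mat n n (\<lambda>(i, j). \<nu> t (- int n + int i + int j))) \<noteq> 0"
    and hankel_Suc: "t \<ge> 0 \<Longrightarrow>
      Determinant.det (Matrix.mat (Suc n) (Suc n) (\<lambda>(i, j). \<nu> t (- int n + int i + int j))) \<noteq> 0"
    and degree_Q: "t \<ge> 0 \<Longrightarrow> degree (Q n t) = n"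
    and lead_coeff_Q: "t \<ge> 0 \<Longrightarrow> Polynomial.coeff (Q n t) n = 1"
    and orthogonal: "t \<ge> 0 \<Longrightarrow> - int n \<le> k \<Longrightarrow> k < 0 \<Longrightarrow> lmoment (\<nu> t) k (Q n t) = 0"
    and recurrence: "t \<ge> 0 \<Longrightarrow>
      Q (Suc n) t = [:- \<beta> (Suc n) t, 1:] * Q n t
        - Polynomial.smult (\<alpha> (Suc n) t) (pCons 0 (Q (n - 1) t))"
    and \<alpha>_1: "t \<ge> 0 \<Longrightarrow> \<alpha> 1 t = 0"
begin

text \<open>The second argument is the exponent of x itself. Orthogonality gives zero for exponents
  from -n to -1; the values at 0 and at \<open>- int (Suc n)\<close>, just outside this window,
  carry the information.\<close>

definition \<sigma> :: "nat \<Rightarrow> int \<Rightarrow> real \<Rightarrow> complex" where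
  "\<sigma> n k t = lmoment (\<nu> t) k (Q n t)"

lemma \<sigma>_eq_0: "t \<ge> 0 \<Longrightarrow> - int n \<le> k \<Longrightarrow> k < 0 \<Longrightarrow> \<sigma> n k t = 0"
  by (simp add: \<sigma>_def orthogonal)

lemma Q_neq_0: "t \<ge> 0 \<Longrightarrow> Q n t \<noteq> 0"
  using lead_coeff_Q[of t n] by auto

text \<open>Otherwise the n+1 consecutive moments from -n to 0 would all vanish, and the Hankel
  matrix of order n+1 would force \<open>Q n t = 0\<close>.\<close>

lemma \<sigma>_0_neq_0:
  assumes t: "t \<ge> 0"
  shows "\<sigma> n 0 t \<noteq> 0"
proof
  assume 0: "\<sigma> n 0 t = 0"
  have "Q n t = 0"
  proof (rule lmoment_hankel_nonsingular[OF hankel_Suc[OF t, of n]])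
    fix k assume "- int n \<le> k" "k < - int n + int (Suc n)"
    then show "lmoment (\<nu> t) k (Q n t) = 0"
      using 0 t orthogonal[of t n k] by (cases "k = 0") (auto simp: \<sigma>_def)
  qed (simp add: degree_Q t)
  with Q_neq_0 t show False by blast
qed

text \<open>The same argument with the window extended at its lower end, to -n-1.\<close>

lemma \<sigma>_minus_neq_0:
  assumes t: "t \<ge> 0"
  shows "\<sigma> n (- int (Suc n)) t \<noteq> 0"
proof
  assume 0: "\<sigma> n (- int (Suc n)) t = 0"
  have "Q n t = 0"
  proof (rule lmoment_hankel_nonsingular[OF hankel[OF t, of "Suc n"]])
    fix k assume "- int (Suc n) \<le> k" "k < - int (Suc n) + int (Suc n)"
    then show "lmoment (\<nu> t) k (Q n t) = 0"
      using 0 t orthogonal[of t n k] by (cases "k = - int (Suc n)") (auto simp: \<sigma>_def)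
  qed (simp add: degree_Q t)
  with Q_neq_0 t show False by blast
qed

lemma \<sigma>_recurrence:
  assumes t: "t \<ge> 0"
  shows "\<sigma> (Suc n) k t =
    \<sigma> n (k + 1) t - \<beta> (Suc n) t * \<sigma> n k t - \<alpha> (Suc n) t * \<sigma> (n - 1) (k + 1) t"
  by (simp add: \<sigma>_def recurrence[OF t] lmoment_add lmoment_diff lmoment_smult lmoment_pCons)

text \<open>At exponent -1 orthogonality kills the left side of the recurrence and its
  \<open>\<beta>\<close> term.\<close>

lemma \<alpha>_eq:
  assumes t: "t \<ge> 0"
  shows "\<alpha> (Suc (Suc n)) t = \<sigma> (Suc n) 0 t / \<sigma> n 0 t"
  using \<sigma>_recurrence[OF t, of "Suc n" "-1"] \<sigma>_0_neq_0[OF t, of n]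
  by (simp add: \<sigma>_eq_0 t field_simps)

lemma \<beta>_1_eq:
  assumes t: "t \<ge> 0"
  shows "\<beta> 1 t = \<sigma> 0 0 t / \<sigma> 0 (-1) t"
  using \<sigma>_recurrence[OF t, of 0 "-1"] \<sigma>_minus_neq_0[OF t, of 0] \<alpha>_1[OF t]
  by (simp add: \<sigma>_eq_0 t field_simps)

text \<open>At exponent -n-2 orthogonality kills the left side of the recurrence and the first term
  on its right.\<close>

lemma \<beta>_\<sigma>_minus:
  assumes t: "t \<ge> 0"
  shows "\<beta> (Suc (Suc n)) t * \<sigma> (Suc n) (- int (Suc (Suc n))) t =
    - \<alpha> (Suc (Suc n)) t * \<sigma> n (- int (Suc n)) t"
  using \<sigma>_recurrence[OF t, of "Suc n" "- int (Suc (Suc n))"]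
  by (simp add: \<sigma>_eq_0 t algebra_simps)

lemma \<beta>_eq:
  assumes t: "t \<ge> 0"
  shows "\<beta> (Suc (Suc n)) t =
    - \<alpha> (Suc (Suc n)) t * \<sigma> n (- int (Suc n)) t / \<sigma> (Suc n) (- int (Suc (Suc n))) t"
  by (rule nonzero_eq_divide_eq[OF \<sigma>_minus_neq_0[OF t], THEN iffD2, OF \<beta>_\<sigma>_minus[OF t]])

lemma \<alpha>_neq_0: "t \<ge> 0 \<Longrightarrow> \<alpha> (Suc (Suc n)) t \<noteq> 0"
  by (simp add: \<alpha>_eq \<sigma>_0_neq_0)

lemma \<beta>_neq_0:
  assumes t: "t \<ge> 0"
  shows "\<beta> (Suc n) t \<noteq> 0"
proof (cases n)
  case 0
  then show ?thesis
    using \<beta>_1_eq[OF t] \<sigma>_0_neq_0[OF t, of 0] \<sigma>_minus_neq_0[OF t, of 0] by simp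
next
  case (Suc m)
  then show ?thesis
    using \<beta>_eq[OF t, of m] \<alpha>_neq_0[OF t, of m] \<sigma>_minus_neq_0[OF t, of m]
      \<sigma>_minus_neq_0[OF t, of "Suc m"] by simp
qed

section \<open>Differentiability in t\<close>

text \<open>The product rule: \<open>Q'\<close> comes from the coefficients, the two shifted terms
  from the moments. Differentiability of the coefficients is a hypothesis because the induction
  below needs this lemma before it is established.\<close>

lemma \<sigma>_has_vector_derivative:
  assumes t: "t \<ge> 0"
    and Q': "\<And>i. ((\<lambda>s. Polynomial.coeff (Q n s) i) has_vector_derivative Polynomial.coeff Q' i)
      (at t within {0..})"
    and deg: "degree Q' \<le> n"
  shows "(\<sigma> n k has_vector_derivative
    lmoment (\<nu> t) k Q' - p * \<sigma> n (k + 1) t - q * \<sigma> n (k - 1) t) (at t within {0..})"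
proof (rule has_vector_derivative_transform_eqI)
  show "((\<lambda>s. \<Sum>i\<le>n. Polynomial.coeff (Q n s) i * \<nu> s (k + int i)) has_vector_derivative
     (\<Sum>i\<le>n. Polynomial.coeff (Q n t) i *
         (- p * \<nu> t (k + int i + 1) - q * \<nu> t (k + int i - 1))
       + Polynomial.coeff Q' i * \<nu> t (k + int i))) (at t within {0..})"
    by (intro has_vector_derivative_sum has_vector_derivative_mult Q' moment_deriv t)
  show "\<sigma> n k s = (\<Sum>i\<le>n. Polynomial.coeff (Q n s) i * \<nu> s (k + int i))" if "s \<in> {0..}" for s
    using that by (simp add: \<sigma>_def lmoment_def degree_Q)
  show "(\<Sum>i\<le>n. Polynomial.coeff (Q n t) i *
         (- p * \<nu> t (k + int i + 1) - q * \<nu> t (k + int i - 1))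
       + Polynomial.coeff Q' i * \<nu> t (k + int i)) =
    lmoment (\<nu> t) k Q' - p * \<sigma> n (k + 1) t - q * \<sigma> n (k - 1) t"
    by (simp add: \<sigma>_def lmoment_def[of _ _ "Q _ _"] lmoment_eq_sum[OF deg] degree_Q t
        sum.distrib sum_subtractf sum_negf sum_distrib_left algebra_simps)
qed (use t in auto)

text \<open>The sum stops below \<open>n\<close> because the leading coefficient is constantly 1;
  this is the drop in degree on which the uniqueness argument rests.\<close>

definition Q_deriv :: "nat \<Rightarrow> real \<Rightarrow> complex poly" where
  "Q_deriv n t = (\<Sum>i<n. Polynomial.monom
     (vector_derivative (\<lambda>s. Polynomial.coeff (Q n s) i) (at t within {0..})) i)"

lemma coeff_Q_deriv:
  "Polynomial.coeff (Q_deriv n t) i =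
    (if i < n then vector_derivative (\<lambda>s. Polynomial.coeff (Q n s) i) (at t within {0..}) else 0)"
  by (simp add: Q_deriv_def coeff_sum sum.delta)

lemma degree_Q_deriv_le: "degree (Q_deriv n t) \<le> n - 1"
  by (rule degree_le) (auto simp: coeff_Q_deriv)

lemma coeff_Q_has_vector_derivative:
  assumes t: "t \<ge> 0"
    and diff: "\<And>i. (\<lambda>s. Polynomial.coeff (Q n s) i) differentiable (at t within {0..})"
  shows "((\<lambda>s. Polynomial.coeff (Q n s) i) has_vector_derivative Polynomial.coeff (Q_deriv n t) i)
    (at t within {0..})"
proof (cases "i < n")
  case True
  then show ?thesis
    using vector_derivative_works[THEN iffD1, OF diff[of i]] by (simp add: coeff_Q_deriv)
next
  case False
  show ?thesis
  proof (rule has_vector_derivative_transform_eqI)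
    show "((\<lambda>s. if i = n then 1 else 0) has_vector_derivative 0) (at t within {0..})"
      by (rule has_vector_derivative_const)
    show "Polynomial.coeff (Q n s) i = (if i = n then 1 else 0)" if "s \<in> {0..}" for s
      using that False lead_coeff_Q[of s n] by (auto simp: coeff_eq_0 degree_Q)
  qed (use t False in \<open>auto simp: coeff_Q_deriv\<close>)
qed

lemma \<sigma>_differentiable:
  assumes "t \<ge> 0"
    and "\<And>i. (\<lambda>s. Polynomial.coeff (Q n s) i) differentiable (at t within {0..})"
  shows "\<sigma> n k differentiable (at t within {0..})"
  using \<sigma>_has_vector_derivative[OF assms(1) coeff_Q_has_vector_derivative[OF assms]]
    degree_Q_deriv_le[of n t]
  by (meson diff_le_self differentiableI_vector le_trans)

lemma coeff_Q_Suc_differentiable: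
  assumes t: "t \<ge> 0"
    and "\<alpha> (Suc n) differentiable (at t within {0..})" "\<beta> (Suc n) differentiable (at t within {0..})"
    and "\<And>i. (\<lambda>s. Polynomial.coeff (Q n s) i) differentiable (at t within {0..})"
    and "\<And>i. (\<lambda>s. Polynomial.coeff (Q (n - 1) s) i) differentiable (at t within {0..})"
  shows "(\<lambda>s. Polynomial.coeff (Q (Suc n) s) i) differentiable (at t within {0..})"
proof (rule differentiable_eqI[OF _ t])
  \<comment> \<open>\<open>?c f i s\<close> is the coefficient of index \<open>i\<close> in x times
    \<open>f s\<close>.\<close>
  let ?c = "\<lambda>f i s. (case i of 0 \<Rightarrow> 0 | Suc j \<Rightarrow> Polynomial.coeff (f s) j)"
  show "(\<lambda>s. ?c (Q n) i s - \<beta> (Suc n) s * Polynomial.coeff (Q n s) i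
      - \<alpha> (Suc n) s * ?c (Q (n - 1)) i s) differentiable (at t within {0..})"
    using assms by (cases i) (auto intro!: derivative_intros)
  show "Polynomial.coeff (Q (Suc n) s) i = ?c (Q n) i s - \<beta> (Suc n) s * Polynomial.coeff (Q n s) i
      - \<alpha> (Suc n) s * ?c (Q (n - 1)) i s" if "s \<ge> 0" for s
    using recurrence[OF that, of n] by (cases i) auto
qed

text \<open>Nothing is assumed about smoothness of \<open>Q\<close>, \<open>\<alpha>\<close> and
  \<open>\<beta>\<close>. In the induction the next \<open>\<alpha>\<close> and
  \<open>\<beta>\<close> are built from moments of the two latest polynomials by quotients with
  nonzero denominators, and the recurrence then yields the next polynomial; hence two consecutive
  polynomials are carried along.\<close>

lemma coeff_Q_\<alpha>_\<beta>_differentiable: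
  assumes t: "t \<ge> 0"
  shows "(\<forall>i. (\<lambda>s. Polynomial.coeff (Q n s) i) differentiable (at t within {0..})) \<and>
    (\<forall>i. (\<lambda>s. Polynomial.coeff (Q (Suc n) s) i) differentiable (at t within {0..})) \<and>
    \<alpha> (Suc n) differentiable (at t within {0..}) \<and> \<beta> (Suc n) differentiable (at t within {0..})"
proof (induction n)
  case 0
  have Q0: "(\<lambda>s. Polynomial.coeff (Q 0 s) i) differentiable (at t within {0..})" for i
  proof (rule differentiable_eqI[OF _ t])
    show "Polynomial.coeff (Q 0 s) i = (if i = 0 then 1 else 0)" if "s \<ge> 0" for s
      using that lead_coeff_Q[of s 0] by (auto simp: coeff_eq_0 degree_Q)
  qed simp
  moreover have \<alpha>: "\<alpha> (Suc 0) differentiable (at t within {0..})"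
    by (rule differentiable_eqI[of "\<lambda>_. 0", OF _ t]) (use \<alpha>_1 in auto)
  moreover have \<beta>: "\<beta> (Suc 0) differentiable (at t within {0..})"
  proof (rule differentiable_eqI[OF _ t])
    show "(\<lambda>s. \<sigma> 0 0 s / \<sigma> 0 (-1) s) differentiable (at t within {0..})"
      using \<sigma>_minus_neq_0[OF t, of 0]
      by (intro differentiable_divide \<sigma>_differentiable t Q0) simp
  qed (use \<beta>_1_eq in simp)
  ultimately show ?case using coeff_Q_Suc_differentiable[OF t \<alpha> \<beta>] by simp
next
  case (Suc n)
  then have Qn: "(\<lambda>s. Polynomial.coeff (Q n s) i) differentiable (at t within {0..})"
    and Q_Suc: "(\<lambda>s. Polynomial.coeff (Q (Suc n) s) i) differentiable (at t within {0..})" for i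
    by auto
  have \<alpha>: "\<alpha> (Suc (Suc n)) differentiable (at t within {0..})"
  proof (rule differentiable_eqI[OF _ t])
    show "(\<lambda>s. \<sigma> (Suc n) 0 s / \<sigma> n 0 s) differentiable (at t within {0..})"
      by (intro differentiable_divide \<sigma>_differentiable t Qn Q_Suc \<sigma>_0_neq_0)
  qed (rule \<alpha>_eq)
  moreover have \<beta>: "\<beta> (Suc (Suc n)) differentiable (at t within {0..})"
  proof (rule differentiable_eqI[OF _ t])
    show "(\<lambda>s. - \<alpha> (Suc (Suc n)) s * \<sigma> n (- int (Suc n)) s / \<sigma> (Suc n) (- int (Suc (Suc n))) s)
        differentiable (at t within {0..})"
      by (intro differentiable_divide differentiable_mult differentiable_minus \<alpha>
          \<sigma>_differentiable t Qn Q_Suc \<sigma>_minus_neq_0)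
  qed (rule \<beta>_eq)
  ultimately show ?case using coeff_Q_Suc_differentiable[OF t \<alpha> \<beta>] Qn Q_Suc by simp
qed

lemmas coeff_Q_deriv_works =
  coeff_Q_has_vector_derivative[OF _ coeff_Q_\<alpha>_\<beta>_differentiable[THEN conjunct1, rule_format]]

section \<open>The time derivative of the orthogonal polynomials\<close>

text \<open>For these exponents \<open>\<sigma> n k\<close> is identically zero on the half-line, so
  the formula for its derivative must vanish.\<close>

lemma lmoment_Q_deriv:
  assumes t: "t \<ge> 0" and k: "- int n \<le> k" "k < 0"
  shows "lmoment (\<nu> t) k (Q_deriv n t) = p * \<sigma> n (k + 1) t + q * \<sigma> n (k - 1) t"
proof -
  have "degree (Q_deriv n t) \<le> n" using degree_Q_deriv_le[of n t] by linarith
  with \<sigma>_has_vector_derivative[OF t coeff_Q_deriv_works] t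
  have "(\<sigma> n k has_vector_derivative
      lmoment (\<nu> t) k (Q_deriv n t) - p * \<sigma> n (k + 1) t - q * \<sigma> n (k - 1) t) (at t within {0..})"
    by blast
  moreover have "(\<sigma> n k has_vector_derivative 0) (at t within {0..})"
    by (rule has_vector_derivative_transform_eqI[OF has_vector_derivative_const[of 0]])
      (use t k in \<open>auto simp: \<sigma>_eq_0\<close>)
  ultimately have "lmoment (\<nu> t) k (Q_deriv n t) - p * \<sigma> n (k + 1) t - q * \<sigma> n (k - 1) t = 0"
    by (rule vector_derivative_unique_within[OF at_within_atLeast_neq_bot[OF t]])
  then show ?thesis by (simp add: algebra_simps)
qed

text \<open>The two sides agree in the n+1 moments from -n-1 to -1, and their difference has degree
  at most n. The \<open>p\<close> part of these moments can be nonzero only at the upper end of the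
  window, the \<open>q\<close> part only at the lower end.\<close>

lemma Q_deriv_Suc:
  assumes t: "t \<ge> 0"
  shows "Q_deriv (Suc n) t =
    Polynomial.smult (p * \<alpha> (Suc (Suc n)) t) (pCons 0 (Q n t) - Q (Suc n) t)
    - Polynomial.smult (q * \<alpha> (Suc (Suc n)) t / \<beta> (Suc (Suc n)) t) (Q n t)"
    (is "_ = ?rhs")
proof -
  let ?a = "\<alpha> (Suc (Suc n)) t" and ?b = "\<beta> (Suc (Suc n)) t"
  have b: "?b \<noteq> 0" by (rule \<beta>_neq_0[OF t])
  have "Q_deriv (Suc n) t - ?rhs = 0"
  proof (rule lmoment_hankel_nonsingular[OF hankel[OF t, of "Suc n"]])
    have "degree (Q_deriv (Suc n) t - ?rhs) \<le> n"
    proof (rule degree_le, intro allI impI)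
      fix i assume i: "n < i"
      \<comment> \<open>Both polynomials are monic of degree n+1, so their difference loses its
        leading term.\<close>
      have "Polynomial.coeff (pCons 0 (Q n t)) i = Polynomial.coeff (Q (Suc n) t) i"
      proof (cases "i = Suc n")
        case True
        then show ?thesis using lead_coeff_Q[OF t] by simp
      next
        case False
        with i show ?thesis by (cases i) (auto simp: coeff_eq_0 degree_Q t)
      qed
      with i show "Polynomial.coeff (Q_deriv (Suc n) t - ?rhs) i = 0"
        by (simp add: coeff_Q_deriv coeff_eq_0 degree_Q t)
    qed
    then show "Q_deriv (Suc n) t - ?rhs = 0 \<or> degree (Q_deriv (Suc n) t - ?rhs) < Suc n"
      by simp
  next
    fix k assume "- int (Suc n) \<le> k" "k < - int (Suc n) + int (Suc n)"
    then have k: "- int (Suc n) \<le> k" "k < 0" by auto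
    have p_part: "\<sigma> (Suc n) (k + 1) t = ?a * \<sigma> n (k + 1) t"
    proof (cases "k = -1")
      case True
      then show ?thesis using \<alpha>_eq[OF t, of n] \<sigma>_0_neq_0[OF t, of n] by simp
    next
      case False
      with k show ?thesis by (simp add: \<sigma>_eq_0 t)
    qed
    have q_part: "\<sigma> (Suc n) (k - 1) t = - ?a / ?b * \<sigma> n k t"
    proof (cases "k = - int (Suc n)")
      case True
      then have k_1: "k - 1 = - int (Suc (Suc n))" by simp
      show ?thesis
        unfolding k_1 unfolding True using \<beta>_\<sigma>_minus[OF t, of n] b by (simp add: field_simps)
    next
      case False
      with k show ?thesis by (simp add: \<sigma>_eq_0 t)
    qed
    have "lmoment (\<nu> t) k ?rhs =
        p * ?a * (\<sigma> n (k + 1) t - \<sigma> (Suc n) k t) - q * ?a / ?b * \<sigma> n k t"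
      by (simp add: lmoment_diff lmoment_smult lmoment_pCons \<sigma>_def)
    also have "\<dots> = lmoment (\<nu> t) k (Q_deriv (Suc n) t)"
      using lmoment_Q_deriv[OF t k] p_part q_part \<sigma>_eq_0[OF t k] by simp
    finally show "lmoment (\<nu> t) k (Q_deriv (Suc n) t - ?rhs) = 0"
      by (simp add: lmoment_diff)
  qed
  then show ?thesis by simp
qed

section \<open>Constant coefficients and the equation for \<open>\<beta>\<close>\<close>

lemma coeff_Q_0_Suc:
  "t \<ge> 0 \<Longrightarrow> Polynomial.coeff (Q (Suc n) t) 0 = - \<beta> (Suc n) t * Polynomial.coeff (Q n t) 0"
  using recurrence[of t n] by simp

lemma coeff_Q_0_neq_0: "t \<ge> 0 \<Longrightarrow> Polynomial.coeff (Q n t) 0 \<noteq> 0"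
proof (induction n)
  case 0
  then show ?case using lead_coeff_Q[of t 0] by simp
next
  case (Suc n)
  then show ?case using coeff_Q_0_Suc[of t n] \<beta>_neq_0[of t n] by simp
qed

text \<open>This is \<open>Q_deriv_Suc\<close> at x = 0, with the constant coefficient of the
  preceding polynomial expressed through \<open>\<beta> n t\<close>. For \<open>n = 0\<close> both
  sides vanish since \<open>\<alpha> 1 t = 0\<close>.\<close>

lemma coeff_Q_0_has_vector_derivative:
  assumes t: "t \<ge> 0"
  shows "((\<lambda>s. Polynomial.coeff (Q n s) 0) has_vector_derivative
      (- p * \<alpha> (Suc n) t + q * \<alpha> (Suc n) t / (\<beta> (Suc n) t * \<beta> n t)) * Polynomial.coeff (Q n t) 0)
    (at t within {0..})"
proof -
  have "Polynomial.coeff (Q_deriv n t) 0 =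
      (- p * \<alpha> (Suc n) t + q * \<alpha> (Suc n) t / (\<beta> (Suc n) t * \<beta> n t)) * Polynomial.coeff (Q n t) 0"
  proof (cases n)
    case 0
    then show ?thesis using \<alpha>_1[OF t] by (simp add: coeff_Q_deriv)
  next
    case (Suc m)
    then show ?thesis using \<beta>_neq_0[OF t, of m] \<beta>_neq_0[OF t, of n]
      by (simp add: Q_deriv_Suc[OF t] coeff_Q_0_Suc[OF t] field_simps)
  qed
  then show ?thesis using coeff_Q_deriv_works[OF t t, of n 0] by simp
qed

text \<open>Up to sign \<open>\<beta> (Suc n)\<close> is a quotient of consecutive constant
  coefficients, so its logarithmic derivative is a difference of theirs.\<close>

theorem \<beta>_has_vector_derivative:
  assumes t: "t \<ge> 0"
  shows "(\<beta> (Suc n) has_vector_derivative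
      p * \<beta> (Suc n) t * (\<alpha> (Suc n) t - \<alpha> (Suc (Suc n)) t)
      + q * \<beta> (Suc n) t * (\<alpha> (Suc (Suc n)) t / (\<beta> (Suc (Suc n)) t * \<beta> (Suc n) t)
          - \<alpha> (Suc n) t / (\<beta> (Suc n) t * \<beta> n t)))
    (at t within {0..})"
proof -
  let ?c = "\<lambda>n s. Polynomial.coeff (Q n s) 0"
  \<comment> \<open>\<open>X n\<close> is the logarithmic derivative of the constant coefficient of
    \<open>Q n\<close>.\<close>
  define X where
    "X n = - p * \<alpha> (Suc n) t + q * \<alpha> (Suc n) t / (\<beta> (Suc n) t * \<beta> n t)" for n
  have nz: "?c n t \<noteq> 0" by (rule coeff_Q_0_neq_0[OF t])
  \<comment> \<open>Some derivative exists; its value is found by differentiating one product in two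
    ways.\<close>
  obtain b' where b': "(\<beta> (Suc n) has_vector_derivative b') (at t within {0..})"
    using coeff_Q_\<alpha>_\<beta>_differentiable[OF t, of n] vector_derivative_works by blast
  have "((\<lambda>s. - \<beta> (Suc n) s * ?c n s) has_vector_derivative
      - \<beta> (Suc n) t * (X n * ?c n t) + - b' * ?c n t) (at t within {0..})"
    unfolding X_def
    by (intro has_vector_derivative_mult has_vector_derivative_minus b'
        coeff_Q_0_has_vector_derivative t)
  moreover have "((\<lambda>s. - \<beta> (Suc n) s * ?c n s) has_vector_derivative
      X (Suc n) * ?c (Suc n) t) (at t within {0..})"
    unfolding X_def
    by (rule has_vector_derivative_transform_eqI
          [OF coeff_Q_0_has_vector_derivative[OF t, of "Suc n"]])
      (use t in \<open>auto simp: coeff_Q_0_Suc\<close>)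
  ultimately have "- \<beta> (Suc n) t * (X n * ?c n t) + - b' * ?c n t = X (Suc n) * ?c (Suc n) t"
    by (rule vector_derivative_unique_within[OF at_within_atLeast_neq_bot[OF t]])
  then have "(b' - \<beta> (Suc n) t * (X (Suc n) - X n)) * ?c n t = 0"
    by (simp add: coeff_Q_0_Suc[OF t] algebra_simps)
  with nz have "b' = \<beta> (Suc n) t * (X (Suc n) - X n)" by simp
  then have "b' = p * \<beta> (Suc n) t * (\<alpha> (Suc n) t - \<alpha> (Suc (Suc n)) t)
      + q * \<beta> (Suc n) t * (\<alpha> (Suc (Suc n)) t / (\<beta> (Suc (Suc n)) t * \<beta> (Suc n) t)
          - \<alpha> (Suc n) t / (\<beta> (Suc n) t * \<beta> n t))"
    by (simp add: X_def algebra_simps)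
  with b' show ?thesis by simp
qed

section \<open>Subleading coefficients and the equation for \<open>\<alpha>\<close>\<close>

text \<open>The coefficient of \<open>x\<^sup>n\<^sup>-\<^sup>1\<close> in \<open>Q\<^sub>n\<close>; the shift by \<open>pCons 0\<close> gives \<open>0\<close> for \<open>n = 0\<close>.\<close>

definition subleading :: "nat \<Rightarrow> real \<Rightarrow> complex" where
  "subleading n t = Polynomial.coeff (pCons 0 (Q n t)) n"

text \<open>Both \<open>Q n t\<close> and, for positive \<open>n\<close>, x times
  \<open>Q (n - 1) t\<close> are monic of degree n, so \<open>\<beta>\<close> and
  \<open>\<alpha>\<close> enter with factor 1. For \<open>n = 0\<close> the last summand is
  zero.\<close>

lemma subleading_Suc:
  assumes t: "t \<ge> 0"
  shows "subleading (Suc n) t = subleading n t - \<beta> (Suc n) t - \<alpha> (Suc n) t"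
  using lead_coeff_Q[OF t] \<alpha>_1[OF t] recurrence[OF t, of n]
  by (cases n) (simp_all add: subleading_def)

text \<open>In \<open>Q_deriv_Suc\<close> the \<open>p\<close> term contributes a difference of
  consecutive subleading coefficients, which \<open>subleading_Suc\<close> evaluates. For
  \<open>n = 0\<close> the factor \<open>\<alpha> 1 t = 0\<close> annihilates the formula.\<close>

lemma subleading_has_vector_derivative:
  assumes t: "t \<ge> 0"
  shows "(subleading n has_vector_derivative
      p * \<alpha> (Suc n) t * (\<beta> n t + \<alpha> n t) - q * \<alpha> (Suc n) t / \<beta> (Suc n) t) (at t within {0..})"
proof (cases n)
  case 0
  then show ?thesis
    using \<alpha>_1[OF t] has_vector_derivative_const[of 0 "at t within {0..}"]
    by (simp add: subleading_def[abs_def])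
next
  case (Suc m)
  have "Polynomial.coeff (Q_deriv n t) m =
      p * \<alpha> (Suc n) t * (subleading m t - subleading n t) - q * \<alpha> (Suc n) t / \<beta> (Suc n) t"
    using lead_coeff_Q[OF t, of m] by (simp add: Suc Q_deriv_Suc[OF t] subleading_def)
  also have "\<dots> = p * \<alpha> (Suc n) t * (\<beta> n t + \<alpha> n t) - q * \<alpha> (Suc n) t / \<beta> (Suc n) t"
    by (simp add: Suc subleading_Suc[OF t])
  finally show ?thesis
    using coeff_Q_deriv_works[OF t t, of n m] by (simp add: subleading_def[abs_def] Suc)
qed

text \<open>\<open>subleading_Suc\<close> is solved for \<open>\<alpha> (Suc n)\<close>; all three
  remaining derivatives are known.\<close>

theorem \<alpha>_has_vector_derivative:
  assumes t: "t \<ge> 0"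
  shows "(\<alpha> (Suc n) has_vector_derivative
      p * \<alpha> (Suc n) t * (\<alpha> n t + \<beta> n t - \<alpha> (Suc (Suc n)) t - \<beta> (Suc n) t)
      + q * \<alpha> (Suc n) t * (1 / \<beta> n t - 1 / \<beta> (Suc n) t))
    (at t within {0..})"
proof (rule has_vector_derivative_transform_eqI)
  show "((\<lambda>s. subleading n s - subleading (Suc n) s - \<beta> (Suc n) s) has_vector_derivative
      (p * \<alpha> (Suc n) t * (\<beta> n t + \<alpha> n t) - q * \<alpha> (Suc n) t / \<beta> (Suc n) t)
      - (p * \<alpha> (Suc (Suc n)) t * (\<beta> (Suc n) t + \<alpha> (Suc n) t)
          - q * \<alpha> (Suc (Suc n)) t / \<beta> (Suc (Suc n)) t)
      - (p * \<beta> (Suc n) t * (\<alpha> (Suc n) t - \<alpha> (Suc (Suc n)) t)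
          + q * \<beta> (Suc n) t * (\<alpha> (Suc (Suc n)) t / (\<beta> (Suc (Suc n)) t * \<beta> (Suc n) t)
              - \<alpha> (Suc n) t / (\<beta> (Suc n) t * \<beta> n t)))) (at t within {0..})"
    (is "(_ has_vector_derivative ?d) _")
    by (intro has_vector_derivative_diff subleading_has_vector_derivative
        \<beta>_has_vector_derivative t)
  have q_part: "\<beta> (Suc n) t * (\<alpha> (Suc (Suc n)) t / (\<beta> (Suc (Suc n)) t * \<beta> (Suc n) t)
      - \<alpha> (Suc n) t / (\<beta> (Suc n) t * \<beta> n t)) =
      \<alpha> (Suc (Suc n)) t / \<beta> (Suc (Suc n)) t - \<alpha> (Suc n) t / \<beta> n t"
    using \<beta>_neq_0[OF t, of n] by (simp add: right_diff_distrib)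
  have q_part': "\<alpha> (Suc n) t * (1 / \<beta> n t - 1 / \<beta> (Suc n) t) =
      \<alpha> (Suc n) t / \<beta> n t - \<alpha> (Suc n) t / \<beta> (Suc n) t"
    by (simp add: right_diff_distrib)
  \<comment> \<open>With the quotients abstracted to \<open>x\<close>, \<open>y\<close>,
    \<open>z\<close>, a polynomial identity remains and no denominators have to be cleared.\<close>
  have ring: "p * a\<^sub>1 * (b\<^sub>0 + a\<^sub>0) - q * x - (p * a\<^sub>2 * (b\<^sub>1 + a\<^sub>1) - q * y)
        - (p * b\<^sub>1 * (a\<^sub>1 - a\<^sub>2) + q * (y - z)) =
      p * a\<^sub>1 * (a\<^sub>0 + b\<^sub>0 - a\<^sub>2 - b\<^sub>1) + q * (z - x)"
    for a\<^sub>0 a\<^sub>1 a\<^sub>2 b\<^sub>0 b\<^sub>1 x y z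
    by (simp add: algebra_simps)
  show "?d = p * \<alpha> (Suc n) t * (\<alpha> n t + \<beta> n t - \<alpha> (Suc (Suc n)) t - \<beta> (Suc n) t)
      + q * \<alpha> (Suc n) t * (1 / \<beta> n t - 1 / \<beta> (Suc n) t)"
    unfolding mult.assoc[of q] times_divide_eq_right[of q, symmetric] q_part q_part' by (rule ring)
  show "\<alpha> (Suc n) s = subleading n s - subleading (Suc n) s - \<beta> (Suc n) s" if "s \<in> {0..}" for s
    using that subleading_Suc[of s n] by simp
qed (simp add: t)

end

section \<open>From the functional to its moments\<close>

lemma linear_functional_on_zero: "linear_functional_on D L \<Longrightarrow> (\<lambda>x. 0) \<in> D"
  unfolding linear_functional_on_def by (elim conjE)

lemma linear_functional_on_add:
  "linear_functional_on D L \<Longrightarrow> f \<in> D \<Longrightarrow> g \<in> D \<Longrightarrow>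
    (\<lambda>x. f x + g x) \<in> D \<and> L (\<lambda>x. f x + g x) = L f + L g"
  unfolding linear_functional_on_def by (elim conjE) (drule (1) bspec, drule (1) bspec)

lemma linear_functional_on_cmult:
  "linear_functional_on D L \<Longrightarrow> f \<in> D \<Longrightarrow>
    (\<lambda>x. c * f x) \<in> D \<and> L (\<lambda>x. c * f x) = c * L f"
  unfolding linear_functional_on_def by (elim conjE) (drule spec, drule (1) bspec)

text \<open>Laws such as the addition of exponents in \<open>x powi k\<close> are used only for
  nonzero x; this carries the resulting identities through \<open>L\<close>.\<close>

lemma linear_functional_on_cong:
  assumes "linear_functional_on D L" "f \<in> D" "\<And>x. x \<noteq> 0 \<Longrightarrow> g x = f x"
  shows "L g = L f"
proof -
  have "\<forall>f\<in>D. \<forall>g. (\<forall>x. x \<noteq> 0 \<longrightarrow> g x = f x) \<longrightarrow> g \<in> D \<and> L g = L f"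
    using assms(1) unfolding linear_functional_on_def by (elim conjE)
  from bspec[OF this assms(2), THEN spec, of g] assms(3) show ?thesis by blast
qed

text \<open>Membership is proved together with the value because additivity is available only inside
  \<open>D\<close>.\<close>

lemma linear_functional_on_sum:
  assumes L: "linear_functional_on D L" and "finite I" and "\<And>i. i \<in> I \<Longrightarrow> f i \<in> D"
  shows "(\<lambda>x. \<Sum>i\<in>I. c i * f i x) \<in> D \<and>
    L (\<lambda>x. \<Sum>i\<in>I. c i * f i x) = (\<Sum>i\<in>I. c i * L (f i))"
  using assms(2,3)
proof (induction I rule: finite_induct)
  case empty
  show ?case
    using linear_functional_on_zero[OF L]
      linear_functional_on_cmult[OF L linear_functional_on_zero[OF L], of 0] by simp
next
  case (insert i I)
  have "(\<lambda>x. c i * f i x) \<in> D \<and> L (\<lambda>x. c i * f i x) = c i * L (f i)"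
    by (intro linear_functional_on_cmult[OF L] insert.prems) simp
  moreover have "(\<lambda>x. \<Sum>i\<in>I. c i * f i x) \<in> D \<and>
      L (\<lambda>x. \<Sum>i\<in>I. c i * f i x) = (\<Sum>i\<in>I. c i * L (f i))"
    by (intro insert.IH insert.prems) simp
  ultimately show ?case
    using linear_functional_on_add[OF L, of "\<lambda>x. c i * f i x" "\<lambda>x. \<Sum>i\<in>I. c i * f i x"]
      insert.hyps by simp
qed

lemma toda_moment_functional_linear:
  "toda_moment_functional p q D L \<Longrightarrow> linear_functional_on D L"
  unfolding toda_moment_functional_def by (elim conjE)

lemma toda_moment_functional_mem:
  "toda_moment_functional p q D L \<Longrightarrow> t \<ge> 0 \<Longrightarrow> (\<lambda>x. toda_weight p q t x * x powi k) \<in> D"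
  unfolding toda_moment_functional_def by (elim conjE) simp

lemma toda_moment_functional_deriv:
  fixes c :: "int \<Rightarrow> real \<Rightarrow> complex"
  assumes "toda_moment_functional p q D L" "t \<ge> 0" "finite K"
    and "\<And>k b. k \<in> K \<Longrightarrow> b \<ge> 0 \<Longrightarrow> abs_continuous_on {0..b} (c k)"
    and "\<And>k. k \<in> K \<Longrightarrow> c k differentiable (at t within {0..})"
  shows "((\<lambda>s. L (\<lambda>x. toda_weight p q s x * (\<Sum>k\<in>K. c k s * x powi k)))
      has_vector_derivative
        L (\<lambda>x. vector_derivative (\<lambda>s. toda_weight p q s x * (\<Sum>k\<in>K. c k s * x powi k))
             (at t within {0..}))) (at t within {0..})"
  using assms(1) unfolding toda_moment_functional_def
  apply (elim conjE)
  apply (drule spec[of _ K], drule spec[of _ c])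
  apply (drule mp)
  using assms(3,4) apply blast
  apply (drule spec[of _ t])
  using assms(2,5) by blast

lemma deformed_functional_lmoment:
  assumes L: "toda_moment_functional p q D L" and t: "t \<ge> 0"
  shows "deformed_functional p q L t (\<lambda>x. x powi k * poly P x) =
    lmoment (\<lambda>k. deformed_functional p q L t (\<lambda>x. x powi k)) k P"
proof -
  let ?w = "toda_weight p q t"
  note lin = toda_moment_functional_linear[OF L] and D = toda_moment_functional_mem[OF L t]
  note sum = linear_functional_on_sum[OF lin, of "{..degree P}" "\<lambda>i x. ?w x * x powi (k + int i)"
      "Polynomial.coeff P", OF finite_atMost D]
  have "L (\<lambda>x. ?w x * (x powi k * poly P x)) =
      L (\<lambda>x. \<Sum>i\<le>degree P. Polynomial.coeff P i * (?w x * x powi (k + int i)))"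
  proof (rule linear_functional_on_cong[OF lin sum[THEN conjunct1]])
    fix x :: complex assume "x \<noteq> 0"
    then show "?w x * (x powi k * poly P x) =
        (\<Sum>i\<le>degree P. Polynomial.coeff P i * (?w x * x powi (k + int i)))"
      by (simp add: poly_altdef sum_distrib_left power_int_add algebra_simps)
  qed
  then show ?thesis
    using sum[THEN conjunct2] by (simp add: deformed_functional_def lmoment_def)
qed

lemma toda_weight_has_vector_derivative:
  "((\<lambda>s. toda_weight p q s x * c) has_vector_derivative
      - (p * x + q / x) * (toda_weight p q t x * c)) (at t within S)"
proof -
  have "((\<lambda>s. - complex_of_real s * (p * x + q / x)) has_vector_derivative
      - (p * x + q / x)) (at t within S)"
    by (auto intro!: derivative_eq_intros)
  from field_vector_diff_chain_within[OF this DERIV_exp[THEN DERIV_subset, OF subset_UNIV]]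
  have "((\<lambda>s. toda_weight p q s x) has_vector_derivative
      - (p * x + q / x) * toda_weight p q t x) (at t within S)"
    by (simp add: toda_weight_def o_def)
  from has_vector_derivative_mult_left[OF this, of c] show ?thesis by (simp add: mult.assoc)
qed

text \<open>Differentiation under \<open>L\<close> is applied to f(x,t) = x^k. The derivative of the
  weight brings down -(p x + q/x), which splits into the two neighbouring powers.\<close>

lemma moment_has_vector_derivative:
  assumes L: "toda_moment_functional p q D L" and t: "t \<ge> 0"
  defines "\<nu> \<equiv> \<lambda>t k. deformed_functional p q L t (\<lambda>x. x powi k)"
  shows "((\<lambda>s. \<nu> s k) has_vector_derivative - p * \<nu> t (k + 1) - q * \<nu> t (k - 1))
    (at t within {0..})"
proof -
  let ?w = "toda_weight p q t"
  note lin = toda_moment_functional_linear[OF L] and D = toda_moment_functional_mem[OF L t]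
  define c :: "int \<Rightarrow> real \<Rightarrow> complex" where "c = (\<lambda>_ _. 1)"
  have "abs_continuous_on S (c j)" for S j
    \<comment> \<open>All increments of a constant vanish, so any positive delta serves.\<close>
    unfolding abs_continuous_on_def c_def by (auto intro: exI[of _ 1])
  moreover have "c j differentiable (at t within {0..})" for j
    by (simp add: c_def)
  ultimately have "((\<lambda>s. L (\<lambda>x. toda_weight p q s x * (\<Sum>j\<in>{k}. c j s * x powi j)))
      has_vector_derivative
        L (\<lambda>x. vector_derivative (\<lambda>s. toda_weight p q s x * (\<Sum>j\<in>{k}. c j s * x powi j))
             (at t within {0..}))) (at t within {0..})"
    by (intro toda_moment_functional_deriv[OF L t]) auto
  moreover have "vector_derivative (\<lambda>s. toda_weight p q s x * x powi k) (at t within {0..}) =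
      - (p * x + q / x) * (?w x * x powi k)" for x
    by (rule vector_derivative_within[OF at_within_atLeast_neq_bot[OF t]
          toda_weight_has_vector_derivative])
  ultimately have der: "((\<lambda>s. \<nu> s k) has_vector_derivative
      L (\<lambda>x. - (p * x + q / x) * (?w x * x powi k))) (at t within {0..})"
    by (simp add: c_def \<nu>_def deformed_functional_def)
  \<comment> \<open>Coefficients of the two powers, for a sum over the distinct exponents k+1 and
    k-1.\<close>
  let ?c = "\<lambda>j. if j = k + 1 then - p else - q"
  note sum = linear_functional_on_sum[OF lin, of "{k + 1, k - 1}" "\<lambda>j x. ?w x * x powi j" ?c,
      OF _ D, simplified]
  have "L (\<lambda>x. - (p * x + q / x) * (?w x * x powi k)) =
      L (\<lambda>x. - (p * (?w x * x powi (k + 1))) - q * (?w x * x powi (k - 1)))"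
  proof (rule linear_functional_on_cong[OF lin])
    fix x :: complex assume "x \<noteq> 0"
    then show "- (p * x + q / x) * (?w x * x powi k) =
        - (p * (?w x * x powi (k + 1))) - q * (?w x * x powi (k - 1))"
      by (simp add: power_int_add power_int_diff field_simps)
  qed (use sum in simp)
  also have "\<dots> = - p * \<nu> t (k + 1) - q * \<nu> t (k - 1)"
    using sum by (simp add: \<nu>_def deformed_functional_def)
  finally show ?thesis using der by simp
qed

theorem theorem1:
  fixes p q :: complex
    and D :: "(complex \<Rightarrow> complex) set"
    and L :: "(complex \<Rightarrow> complex) \<Rightarrow> complex"
    and Q :: "nat \<Rightarrow> real \<Rightarrow> complex poly"
    and \<alpha> \<beta> \<gamma> :: "nat \<Rightarrow> real \<Rightarrow> complex"
  assumes L: "toda_moment_functional p q D L"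
    and hankel: "\<And>n t. t \<ge> 0 \<Longrightarrow> hankel_det (deformed_functional p q L t) (- int n) n \<noteq> 0"
    and hankel_Suc: "\<And>n t. t \<ge> 0 \<Longrightarrow> hankel_det (deformed_functional p q L t) (- int n) (n + 1) \<noteq> 0"
    and Q: "\<And>n t. t \<ge> 0 \<Longrightarrow> L_orthogonal_poly (deformed_functional p q L t) n (Q n t)"
    and Q_1: "\<And>t. t \<ge> 0 \<Longrightarrow> Q 1 t = [:- \<beta> 1 t, 1:]"
    and recurrence: "\<And>n t. n \<ge> 1 \<Longrightarrow> t \<ge> 0 \<Longrightarrow>
      Q (n + 1) t = [:- \<beta> (n + 1) t, 1:] * Q n t - Polynomial.smult (\<alpha> (n + 1) t) ([:0, 1:] * Q (n - 1) t)"
    and \<beta>_0: "\<And>t. t \<ge> 0 \<Longrightarrow> \<beta> 0 t = 1"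
    and \<alpha>_0: "\<And>t. t \<ge> 0 \<Longrightarrow> \<alpha> 0 t = -1"
    and \<alpha>_1: "\<And>t. t \<ge> 0 \<Longrightarrow> \<alpha> 1 t = 0"
    and \<gamma>: "\<And>n t. n \<ge> 1 \<Longrightarrow> t \<ge> 0 \<Longrightarrow> \<gamma> n t = \<alpha> (n + 1) t + \<beta> n t"
  shows "\<forall>n\<ge>1. \<forall>t\<ge>0.
    (\<beta> n has_vector_derivative
        p * \<beta> n t * (\<alpha> n t - \<alpha> (n + 1) t)
        + q * \<beta> n t * (\<alpha> (n + 1) t / (\<beta> (n + 1) t * \<beta> n t) - \<alpha> n t / (\<beta> n t * \<beta> (n - 1) t)))
      (at t within {0..}) \<and>
    (\<alpha> n has_vector_derivative
        p * \<alpha> n t * (\<alpha> (n - 1) t + \<beta> (n - 1) t - \<alpha> (n + 1) t - \<beta> n t)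
        + q * \<alpha> n t * (1 / \<beta> (n - 1) t - 1 / \<beta> n t))
      (at t within {0..}) \<and>
    (\<gamma> n has_vector_derivative
        p * (\<alpha> n t * \<gamma> n t - \<alpha> (n + 1) t * \<gamma> (n + 1) t)
        + q * (\<alpha> (n + 1) t / \<beta> n t - \<alpha> n t / \<beta> (n - 1) t))
      (at t within {0..})"
proof -
  let ?M = "deformed_functional p q L"
  define \<nu> where "\<nu> = (\<lambda>t k. ?M t (\<lambda>x. x powi k))"
  interpret toda_L_orthogonal p q \<nu> Q \<alpha> \<beta>
  proof
    fix t :: real and n :: nat and k :: int
    assume t: "t \<ge> 0"
    show "((\<lambda>s. \<nu> s k) has_vector_derivative - p * \<nu> t (k + 1) - q * \<nu> t (k - 1))
        (at t within {0..})"
      unfolding \<nu>_def by (rule moment_has_vector_derivative[OF L t])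
    show "Determinant.det (Matrix.mat n n (\<lambda>(i, j). \<nu> t (- int n + int i + int j))) \<noteq> 0"
      using hankel[OF t, of n] by (simp add: hankel_det_def \<nu>_def)
    show "Determinant.det
        (Matrix.mat (Suc n) (Suc n) (\<lambda>(i, j). \<nu> t (- int n + int i + int j))) \<noteq> 0"
      using hankel_Suc[OF t, of n] by (simp add: hankel_det_def \<nu>_def)
    show deg: "degree (Q n t) = n" "Polynomial.coeff (Q n t) n = 1" for n
      using Q[OF t, of n] by (auto simp: L_orthogonal_poly_def)
    show "lmoment (\<nu> t) k (Q n t) = 0" if k: "- int n \<le> k" "k < 0"
    proof -
      \<comment> \<open>This number is the index s in the definition of L-orthogonality, where the
        exponent is -n+s.\<close>
      have "nat (k + int n) < n" "k = - int n + int (nat (k + int n))" using k by auto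
      then have "?M t (\<lambda>x. x powi k * poly (Q n t) x) = 0"
        using Q[OF t, of n] unfolding L_orthogonal_poly_def by metis
      then show ?thesis unfolding \<nu>_def by (simp add: deformed_functional_lmoment[OF L t])
    qed
    show "\<alpha> 1 t = 0" by (rule \<alpha>_1[OF t])
    show "Q (Suc n) t = [:- \<beta> (Suc n) t, 1:] * Q n t
        - Polynomial.smult (\<alpha> (Suc n) t) (pCons 0 (Q (n - 1) t))"
    proof (cases n)
      \<comment> \<open>The separately given \<open>Q 1\<close> fits the general recurrence because
        \<open>\<alpha> 1 t = 0\<close> and \<open>Q 0 t = 1\<close>.\<close>
      case 0
      have "Q 0 t = 1"
        using deg[of 0] by (metis degree_0_id of_nat_1 one_pCons)
      then show ?thesis using 0 Q_1[OF t] \<alpha>_1[OF t] by simp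
    next
      case (Suc m)
      then show ?thesis using recurrence[OF _ t, of n] by simp
    qed
  qed
  show ?thesis
  proof (intro allI impI)
    fix n :: nat and t :: real
    assume "n \<ge> 1" and t: "t \<ge> 0"
    then obtain m where n: "n = Suc m" by (cases n) auto
    let ?\<beta>' = "p * \<beta> n t * (\<alpha> n t - \<alpha> (n + 1) t)
        + q * \<beta> n t * (\<alpha> (n + 1) t / (\<beta> (n + 1) t * \<beta> n t) - \<alpha> n t / (\<beta> n t * \<beta> (n - 1) t))"
    let ?\<alpha>' = "p * \<alpha> n t * (\<alpha> (n - 1) t + \<beta> (n - 1) t - \<alpha> (n + 1) t - \<beta> n t)
        + q * \<alpha> n t * (1 / \<beta> (n - 1) t - 1 / \<beta> n t)"
    have \<beta>': "(\<beta> n has_vector_derivative ?\<beta>') (at t within {0..})"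
      using \<beta>_has_vector_derivative[OF t, of m] by (simp add: n)
    have \<alpha>': "(\<alpha> n has_vector_derivative ?\<alpha>') (at t within {0..})"
      using \<alpha>_has_vector_derivative[OF t, of m] by (simp add: n)
    \<comment> \<open>Since \<open>\<gamma> n\<close> contains \<open>\<alpha> (n + 1)\<close>, the
      equation for \<open>\<alpha>\<close> is taken one index higher.\<close>
    have \<alpha>_Suc': "(\<alpha> (n + 1) has_vector_derivative
        p * \<alpha> (n + 1) t * (\<alpha> n t + \<beta> n t - \<alpha> (n + 1 + 1) t - \<beta> (n + 1) t)
        + q * \<alpha> (n + 1) t * (1 / \<beta> n t - 1 / \<beta> (n + 1) t)) (at t within {0..})"
      (is "(_ has_vector_derivative ?\<alpha>_Suc') _")
      using \<alpha>_has_vector_derivative[OF t, of n] by simp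
    have q_part: "\<beta> n t * (\<alpha> (n + 1) t / (\<beta> (n + 1) t * \<beta> n t) - \<alpha> n t / (\<beta> n t * \<beta> (n - 1) t)) =
        \<alpha> (n + 1) t / \<beta> (n + 1) t - \<alpha> n t / \<beta> (n - 1) t"
      using \<beta>_neq_0[OF t, of m] by (simp add: n right_diff_distrib)
    have q_part': "\<alpha> (n + 1) t * (1 / \<beta> n t - 1 / \<beta> (n + 1) t) =
        \<alpha> (n + 1) t / \<beta> n t - \<alpha> (n + 1) t / \<beta> (n + 1) t"
      by (simp add: right_diff_distrib)
    \<comment> \<open>Here \<open>y\<close> stands for
      \<open>\<alpha> (n + 1) t / \<beta> (n + 1) t\<close>, which cancels between the two
      equations.\<close>
    have ring: "p * a\<^sub>2 * (a\<^sub>1 + b\<^sub>1 - a\<^sub>3 - b\<^sub>2) + q * (z - y)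
          + (p * b\<^sub>1 * (a\<^sub>1 - a\<^sub>2) + q * (y - x)) =
        p * (a\<^sub>1 * (a\<^sub>2 + b\<^sub>1) - a\<^sub>2 * (a\<^sub>3 + b\<^sub>2)) + q * (z - x)"
      for a\<^sub>1 a\<^sub>2 a\<^sub>3 b\<^sub>1 b\<^sub>2 x y z
      by (simp add: algebra_simps)
    have \<gamma>_Suc: "\<gamma> (n + 1) t = \<alpha> (n + 1 + 1) t + \<beta> (n + 1) t"
      by (rule \<gamma>) (use t in auto)
    have "?\<alpha>_Suc' + ?\<beta>' = p * (\<alpha> n t * \<gamma> n t - \<alpha> (n + 1) t * \<gamma> (n + 1) t)
        + q * (\<alpha> (n + 1) t / \<beta> n t - \<alpha> n t / \<beta> (n - 1) t)"
      unfolding mult.assoc[of q] q_part q_part' \<gamma>[OF \<open>n \<ge> 1\<close> t] \<gamma>_Suc by (rule ring)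
    then have "(\<gamma> n has_vector_derivative p * (\<alpha> n t * \<gamma> n t - \<alpha> (n + 1) t * \<gamma> (n + 1) t)
        + q * (\<alpha> (n + 1) t / \<beta> n t - \<alpha> n t / \<beta> (n - 1) t)) (at t within {0..})"
      by (intro has_vector_derivative_transform_eqI
            [OF has_vector_derivative_add[OF \<alpha>_Suc' \<beta>']])
        (use t \<gamma>[OF \<open>n \<ge> 1\<close>] in auto)
    with \<alpha>' \<beta>' show "(\<beta> n has_vector_derivative ?\<beta>') (at t within {0..}) \<and>
        (\<alpha> n has_vector_derivative ?\<alpha>') (at t within {0..}) \<and>
        (\<gamma> n has_vector_derivative p * (\<alpha> n t * \<gamma> n t - \<alpha> (n + 1) t * \<gamma> (n + 1) t)
          + q * (\<alpha> (n + 1) t / \<beta> n t - \<alpha> n t / \<beta> (n - 1) t)) (at t within {0..})"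
      by blast
  qed
qed

end
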